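(* Let $\Gamma$ be a free Borel $\mathbb{Z}^d$-action generated by commuting Borel automorphisms $T_1,\dots,T_d$ of a standard Borel space $(X,\mathcal{B})$. Then for any $d$-tuple $(t_1,\dots,t_d)$ of positive integers there exists a Borel set $A\subseteq X$ such that (i) $A$ is a complete section for $\Gamma$; (ii) the sets $T_1^{k_1}\cdots T_d^{k_d}A$, for integers $0\leq k_i<t_i$, $i=1,2,\dots,d$, are pairwise disjoint (for distinct tuples $(k_1,\dots,k_d)$).
   Context: A standard Borel space is a pair $(X,\mathcal{B})$ with $X$ a Polish space and $\mathcal{B}$ its Borel $\sigma$-algebra. A Borel automorphism of $(X,\mathcal{B})$ is a one-to-one Borel map of $X$ onto itself. Here $d$ is a positive integer. Commuting Borel automorphisms $T_1,\dots,T_d$ generate a free Borel $\mathbb{Z}^d$-action, given by $(n_1,\dots,n_d)\mapsto T_1^{n_1}\cdots T_d^{n_d}$, if $T_1^{n_1}\cdots T_d^{n_d}x\neq x$ for all $x\in X$ and all $(n_1,\dots,n_d)\in\mathbb{Z}^d\setminus\{(0,\dots,0)\}$. A Borel set $A$ is a complete section for $\Gamma$ if every $\Gamma$-orbit intersects $A$. *)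

theory Defs
  imports "HOL-Analysis.Analysis"
begin

text \<open>
  Standard Borel spaces are carried by a type \<open>'a measure\<close>, of which only the carrier
  \<open>space M\<close> and the sigma-algebra \<open>sets M\<close> matter; the measure itself is never used.
\<close>

definition polish_topology :: "'a topology \<Rightarrow> bool" where
  "polish_topology X \<longleftrightarrow> separable_space X \<and> completely_metrizable_space X"

definition standard_borel_space :: "'a measure \<Rightarrow> bool" where
  "standard_borel_space M \<longleftrightarrow>
     (\<exists>X. polish_topology X \<and> space M = topspace X \<and>
          sets M = sigma_sets (topspace X) {U. openin X U})"

text \<open>Measurability of the inverse map is not part of the definition.\<close>

definition borel_automorphism :: "'a measure \<Rightarrow> ('a \<Rightarrow> 'a) \<Rightarrow> bool" where
  "borel_automorphism M f \<longleftrightarrow> f \<in> measurable M M \<and> bij_betw f (space M) (space M)"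

definition int_iterate :: "'a measure \<Rightarrow> ('a \<Rightarrow> 'a) \<Rightarrow> int \<Rightarrow> 'a \<Rightarrow> 'a" where
  "int_iterate M f n =
     (if n \<ge> 0 then f ^^ nat n else inv_into (space M) f ^^ nat (- n))"

text \<open>
  \<open>zd_map M T d n\<close> is \<open>T 1 ^ n 1 \<circ> \<dots> \<circ> T d ^ n d\<close>. Elements of \<open>\<int>\<^sup>d\<close> are functions
  \<open>nat \<Rightarrow> int\<close> of which only the values on \<open>{1..d}\<close> are used.
\<close>

primrec zd_map :: "'a measure \<Rightarrow> (nat \<Rightarrow> 'a \<Rightarrow> 'a) \<Rightarrow> nat \<Rightarrow> (nat \<Rightarrow> int) \<Rightarrow> 'a \<Rightarrow> 'a" where
  "zd_map M T 0 n = id"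
| "zd_map M T (Suc d) n = zd_map M T d n \<circ> int_iterate M (T (Suc d)) (n (Suc d))"

definition generate_free_borel_zd_action :: "'a measure \<Rightarrow> nat \<Rightarrow> (nat \<Rightarrow> 'a \<Rightarrow> 'a) \<Rightarrow> bool" where
  "generate_free_borel_zd_action M d T \<longleftrightarrow>
     (\<forall>i\<in>{1..d}. borel_automorphism M (T i)) \<and>
     (\<forall>i\<in>{1..d}. \<forall>j\<in>{1..d}. \<forall>x\<in>space M. T i (T j x) = T j (T i x)) \<and>
     (\<forall>x\<in>space M. \<forall>n. (\<exists>i\<in>{1..d}. n i \<noteq> 0) \<longrightarrow> zd_map M T d n x \<noteq> x)"

definition zd_orbit :: "'a measure \<Rightarrow> nat \<Rightarrow> (nat \<Rightarrow> 'a \<Rightarrow> 'a) \<Rightarrow> 'a \<Rightarrow> 'a set" where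
  "zd_orbit M d T x = range (\<lambda>n. zd_map M T d n x)"

definition complete_section :: "'a measure \<Rightarrow> nat \<Rightarrow> (nat \<Rightarrow> 'a \<Rightarrow> 'a) \<Rightarrow> 'a set \<Rightarrow> bool" where
  "complete_section M d T A \<longleftrightarrow>
     A \<in> sets M \<and> (\<forall>x\<in>space M. zd_orbit M d T x \<inter> A \<noteq> {})"

end

theory Submission
  imports Defs
begin

text \<open>
  The sets \<open>T\<^sup>k A\<close> with \<open>k\<close> in the box are pairwise disjoint iff \<open>A\<close> is disjoint from \<open>T\<^sup>f A\<close> for
  every nonzero difference \<open>f\<close> of two elements of the box. There are finitely many such \<open>f\<close>; let
  \<open>G\<close> consist of them and of their negatives.

  \<^emph>\<open>A colouring.\<close> A Polish space has countably many Borel sets \<open>U\<^sub>0, U\<^sub>1, \<dots>\<close> such that each point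
  can be separated from each finite set not containing it by some \<open>U\<^sub>n\<close>
  (\<open>standard_borel_space_separating_sequence\<close>). By freeness \<open>T\<^sup>f x \<noteq> x\<close> for \<open>f \<in> G\<close>, so one may
  let \<open>c x\<close> be the least \<open>n\<close> for which \<open>U\<^sub>n\<close> contains \<open>x\<close> but no \<open>T\<^sup>f x\<close> with \<open>f \<in> G\<close>. Then
  \<open>c (T\<^sup>f x) \<noteq> c x\<close>.

  \<^emph>\<open>Strict local minima.\<close> Let \<open>A'\<close> be the set of all \<open>x\<close> with \<open>c x < c (T\<^sup>f x)\<close> for all
  \<open>f \<in> G\<close>. It is disjoint from \<open>T\<^sup>f A'\<close>, since of two points of \<open>A'\<close> that differ by \<open>f\<close> each would
  have a smaller colour than the other. It meets every orbit, because the colours are natural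
  numbers: a point of least colour in its orbit lies in \<open>A'\<close>.

  \<^emph>\<open>Measurability.\<close> Whether \<open>x\<close> lies in \<open>A'\<close> depends on points \<open>T\<^sup>n x\<close> with negative entries in
  \<open>n\<close>, and the inverse of a bijective Borel map is Borel only by the Lusin--Souslin theorem. That
  theorem can be avoided: choose \<open>s\<close> with \<open>s + f \<ge> 0\<close> for all \<open>f \<in> G\<close> and replace \<open>A'\<close> by its
  preimage \<open>A\<close> under \<open>T\<^sup>2\<^sup>s\<close>. Translation by a group element preserves the two properties above,
  and membership in \<open>A\<close> is expressed by nonnegative iterates only
  (\<open>complete_section_avoiding_translates\<close>).
\<close>

section \<open>Integer iterates of a bijection\<close>

lemma int_iterate_in_space:
  assumes f: "bij_betw f (space M) (space M)" and x: "x \<in> space M"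
  shows "int_iterate M f n x \<in> space M"
proof -
  have "(f ^^ k) x \<in> space M" for k
    using x bij_betwE[OF f] by (induction k) auto
  moreover have "(inv_into (space M) f ^^ k) x \<in> space M" for k
    using x bij_betwE[OF bij_betw_inv_into[OF f]] by (induction k) auto
  ultimately show ?thesis
    by (simp add: int_iterate_def)
qed

lemma int_iterate_step:
  assumes f: "bij_betw f (space M) (space M)" and x: "x \<in> space M"
  shows "int_iterate M f (n + 1) x = f (int_iterate M f n x)"
proof (cases "n \<ge> 0")
  case True
  then have "nat (n + 1) = Suc (nat n)"
    by simp
  with True show ?thesis
    by (simp add: int_iterate_def)
next
  case False
  let ?g = "inv_into (space M) f"
  have neg: "int_iterate M f k = ?g ^^ nat (- k)" if "k \<le> 0" for k
    using that by (auto simp: int_iterate_def)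
  have "nat (- n) = Suc (nat (- (n + 1)))"
    using False by simp
  then have "int_iterate M f n x = ?g (int_iterate M f (n + 1) x)"
    using False by (simp add: neg)
  then show ?thesis
    using bij_betw_inv_into_right[OF f int_iterate_in_space[OF f x]] by simp
qed

lemma int_iterate_add:
  assumes f: "bij_betw f (space M) (space M)" and x: "x \<in> space M"
  shows "int_iterate M f (m + n) x = int_iterate M f m (int_iterate M f n x)"
proof (induction m rule: int_induct[where k = 0])
  case base
  show ?case by (simp add: int_iterate_def)
next
  case (step1 m)
  then show ?case
    using int_iterate_step[OF f x, of "m + n"]
      int_iterate_step[OF f int_iterate_in_space[OF f x], of m n]
    by (simp add: algebra_simps)
next
  case (step2 m)
  have "f (int_iterate M f (m - 1 + n) x) = f (int_iterate M f (m - 1) (int_iterate M f n x))"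
    using step2.IH int_iterate_step[OF f x, of "m - 1 + n"]
      int_iterate_step[OF f int_iterate_in_space[OF f x], of "m - 1" n]
    by (simp add: algebra_simps)
  then show ?case
    using bij_betw_imp_inj_on[OF f] f x by (meson inj_onD int_iterate_in_space)
qed

lemma int_iterate_commute:
  assumes f: "bij_betw f (space M) (space M)" and x: "x \<in> space M"
    and h: "\<And>y. y \<in> space M \<Longrightarrow> h y \<in> space M"
    and comm: "\<And>y. y \<in> space M \<Longrightarrow> h (f y) = f (h y)"
  shows "h (int_iterate M f n x) = int_iterate M f n (h x)"
proof (induction n rule: int_induct[where k = 0])
  case base
  show ?case by (simp add: int_iterate_def)
next
  case (step1 n)
  then show ?case
    by (simp add: int_iterate_step f x h comm int_iterate_in_space)
next
  case (step2 n)
  have "f (h (int_iterate M f (n - 1) x)) = h (int_iterate M f n x)"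
    using int_iterate_step[OF f x, of "n - 1"] by (simp add: comm int_iterate_in_space f x)
  also have "\<dots> = f (int_iterate M f (n - 1) (h x))"
    using step2.IH int_iterate_step[OF f h[OF x], of "n - 1"] by simp
  finally show ?case
    using bij_betw_imp_inj_on[OF f] f x h by (meson inj_onD int_iterate_in_space)
qed

section \<open>The action of \<open>\<int>\<^sup>d\<close>\<close>

lemma zd_map_cong:
  assumes "\<And>i. i \<in> {1..d} \<Longrightarrow> m i = n i"
  shows "zd_map M T d m = zd_map M T d n"
  using assms by (induction d) auto

lemma zd_map_in_space:
  assumes "\<forall>i\<in>{1..d}. bij_betw (T i) (space M) (space M)" and "x \<in> space M"
  shows "zd_map M T d n x \<in> space M"
  using assms by (induction d arbitrary: x) (auto simp: int_iterate_in_space)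

lemma zd_map_measurable:
  assumes "\<forall>i\<in>{1..d}. T i \<in> measurable M M" and "\<forall>i\<in>{1..d}. n i \<ge> 0"
  shows "zd_map M T d n \<in> measurable M M"
  using assms
proof (induction d)
  case 0
  show ?case by (simp add: measurable_ident)
next
  case (Suc d)
  have "int_iterate M (T (Suc d)) (n (Suc d)) \<in> measurable M M"
    using Suc.prems measurable_compose_n[of "T (Suc d)" M] by (simp add: int_iterate_def)
  with Suc show ?case
    by (auto intro: measurable_comp)
qed

lemma zd_map_commute:
  assumes T: "\<forall>i\<in>{1..d}. bij_betw (T i) (space M) (space M)" and x: "x \<in> space M"
    and h: "\<And>y. y \<in> space M \<Longrightarrow> h y \<in> space M"
    and comm: "\<And>i y. i \<in> {1..d} \<Longrightarrow> y \<in> space M \<Longrightarrow> h (T i y) = T i (h y)"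
  shows "h (zd_map M T d n x) = zd_map M T d n (h x)"
  using T x comm
proof (induction d arbitrary: x)
  case 0
  show ?case by simp
next
  case (Suc d)
  have bij: "bij_betw (T (Suc d)) (space M) (space M)"
    using Suc.prems(1) by simp
  have "h (int_iterate M (T (Suc d)) (n (Suc d)) x) = int_iterate M (T (Suc d)) (n (Suc d)) (h x)"
    by (rule int_iterate_commute[OF bij Suc.prems(2) h]) (use Suc.prems(3) in auto)
  with Suc.IH[of "int_iterate M (T (Suc d)) (n (Suc d)) x"] Suc.prems show ?case
    by (simp add: int_iterate_in_space)
qed

lemma zd_map_add:
  assumes T: "\<forall>i\<in>{1..d}. bij_betw (T i) (space M) (space M)"
    and comm: "\<forall>i\<in>{1..d}. \<forall>j\<in>{1..d}. \<forall>x\<in>space M. T i (T j x) = T j (T i x)"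
    and x: "x \<in> space M"
  shows "zd_map M T d (\<lambda>i. m i + n i) x = zd_map M T d m (zd_map M T d n x)"
  using assms
proof (induction d arbitrary: x)
  case 0
  show ?case by simp
next
  case (Suc d)
  let ?S = "\<lambda>k. int_iterate M (T (Suc d)) k"
  have bij: "bij_betw (T (Suc d)) (space M) (space M)"
    and bijs: "\<forall>i\<in>{1..d}. bij_betw (T i) (space M) (space M)"
    using Suc.prems(1) by simp_all
  have S: "?S k y \<in> space M" if "y \<in> space M" for k y
    using that bij by (rule int_iterate_in_space[rotated])
  have S_T: "?S k (T i y) = T i (?S k y)" if "i \<in> {1..d}" "y \<in> space M" for i k y
  proof (rule int_iterate_commute[OF bij that(2), symmetric])
    show "T i z \<in> space M" if "z \<in> space M" for z
      using bijs \<open>i \<in> {1..d}\<close> that by (meson bij_betwE)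
    show "T i (T (Suc d) z) = T (Suc d) (T i z)" if "z \<in> space M" for z
      using Suc.prems(2) \<open>i \<in> {1..d}\<close> that by simp
  qed
  have "zd_map M T (Suc d) (\<lambda>i. m i + n i) x
      = zd_map M T d (\<lambda>i. m i + n i) (?S (m (Suc d)) (?S (n (Suc d)) x))"
    by (simp add: int_iterate_add[OF bij Suc.prems(3)])
  also have "\<dots> = zd_map M T d m (zd_map M T d n (?S (m (Suc d)) (?S (n (Suc d)) x)))"
    by (rule Suc.IH) (use Suc.prems S in auto)
  also have "zd_map M T d n (?S (m (Suc d)) (?S (n (Suc d)) x))
      = ?S (m (Suc d)) (zd_map M T d n (?S (n (Suc d)) x))"
    by (rule zd_map_commute[OF bijs, symmetric]) (use Suc.prems(3) S S_T in auto)
  finally show ?case by simp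
qed

section \<open>Separating points from finite sets\<close>

text \<open>The balls of radius \<open>1 / (n + 1)\<close> around the points of a countable dense set will do.\<close>

lemma standard_borel_space_separating_sequence:
  assumes "standard_borel_space M"
  obtains U :: "nat \<Rightarrow> 'a set" where "\<And>n. U n \<in> sets M"
    and "\<And>x E. x \<in> space M \<Longrightarrow> finite E \<Longrightarrow> E \<subseteq> space M \<Longrightarrow> x \<notin> E \<Longrightarrow>
           \<exists>n. x \<in> U n \<and> U n \<inter> E = {}"
proof -
  obtain X where X: "separable_space X" "completely_metrizable_space X"
    and space: "space M = topspace X"
    and sets: "sets M = sigma_sets (topspace X) {U. openin X U}"
    using assms unfolding standard_borel_space_def polish_topology_def by auto
  obtain S D where met: "Metric_space S D" and X_eq: "X = Metric_space.mtopology S D"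
    using X(2) unfolding completely_metrizable_space_def by auto
  interpret Metric_space S D by (rule met)
  obtain C where C: "countable C" "C \<subseteq> S" "mtopology closure_of C = S"
    using X(1) unfolding separable_space_def X_eq by auto
  define \<B> where "\<B> = insert {} ((\<lambda>(c, n). mball c (1 / real (Suc n))) ` (C \<times> (UNIV :: nat set)))"
  define U where "U = from_nat_into \<B>"
  have range_U: "range U = \<B>"
    unfolding U_def \<B>_def using C(1) by (intro range_from_nat_into) auto
  show ?thesis
  proof (rule that)
    fix n
    have "U n \<in> \<B>"
      using range_U by blast
    then have "openin X (U n)"
      unfolding \<B>_def X_eq by auto
    then show "U n \<in> sets M"
      unfolding sets by (simp add: sigma_sets.Basic)
  next
    fix x E
    assume x: "x \<in> space M" and E: "finite E" "E \<subseteq> space M" "x \<notin> E"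
    have xS: "x \<in> S"
      using x space X_eq by simp
    have "closedin mtopology E"
      using E space X_eq metrizable_imp_t1_space[OF metrizable_space_mtopology]
      by (simp add: t1_space_closedin_finite)
    then have "openin mtopology (S - E)"
      by (metis openin_diff openin_topspace topspace_mtopology)
    then obtain r where r: "r > 0" "mball x r \<subseteq> S - E"
      using xS E(3) unfolding openin_mtopology by auto
    obtain n where n: "1 / real (Suc n) < r / 2"
      by (rule nat_approx_posE[OF half_gt_zero[OF r(1)]])
    let ?e = "1 / real (Suc n)"
    have "x \<in> mtopology closure_of C"
      using C(3) xS by simp
    moreover have "?e > 0"
      by simp
    ultimately obtain c where c: "c \<in> C" "c \<in> mball x ?e"
      unfolding metric_closure_of by blast
    have cS: "c \<in> S" and dist: "D x c < ?e"
      using c(2) by auto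
    have "mball c ?e \<subseteq> mball x r"
    proof
      fix y
      assume "y \<in> mball c ?e"
      then have "y \<in> S" "D c y < ?e"
        by auto
      then show "y \<in> mball x r"
        using triangle[OF xS cS \<open>y \<in> S\<close>] dist n xS by simp
    qed
    moreover have "x \<in> mball c ?e"
      using dist cS xS by (simp add: commute)
    moreover have "mball c ?e \<in> range U"
      unfolding range_U \<B>_def using c(1)
      by (intro insertI2 image_eqI[where x = "(c, n)"]) simp_all
    then obtain k where "mball c ?e = U k"
      by blast
    ultimately show "\<exists>n. x \<in> U n \<and> U n \<inter> E = {}"
      using r(2) by (intro exI[of _ k]) blast
  qed
qed

section \<open>A complete section of local colour minima\<close>

text \<open>
  Strict local minima of a colouring by natural numbers cannot be neighbours, and every orbit
  has one. Here \<open>x\<close> and \<open>y\<close> are neighbours if they differ by an element of \<open>F\<close> or of \<open>- F\<close>, and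
  \<open>A\<close> is the set of local minima pulled back far enough that only nonnegative iterates enter its
  definition.
\<close>

lemma complete_section_avoiding_translates:
  fixes F :: "(nat \<Rightarrow> int) set"
  assumes borel: "standard_borel_space M"
    and action: "generate_free_borel_zd_action M d T"
    and F: "finite F" "\<And>f. f \<in> F \<Longrightarrow> \<exists>i\<in>{1..d}. f i \<noteq> 0"
  obtains A where "complete_section M d T A"
    and "\<And>f x. f \<in> F \<Longrightarrow> x \<in> A \<Longrightarrow> zd_map M T d f x \<notin> A"
proof -
  let ?act = "zd_map M T d"
  have bij: "\<forall>i\<in>{1..d}. bij_betw (T i) (space M) (space M)"
    and meas: "\<forall>i\<in>{1..d}. T i \<in> measurable M M"
    and comm: "\<forall>i\<in>{1..d}. \<forall>j\<in>{1..d}. \<forall>x\<in>space M. T i (T j x) = T j (T i x)"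
    and free: "\<And>x n. x \<in> space M \<Longrightarrow> \<exists>i\<in>{1..d}. n i \<noteq> 0 \<Longrightarrow> ?act n x \<noteq> x"
    using action unfolding generate_free_borel_zd_action_def borel_automorphism_def by auto
  have act_space: "?act n x \<in> space M" if "x \<in> space M" for n x
    using bij that by (rule zd_map_in_space)
  have act_act: "?act m (?act n x) = ?act (\<lambda>i. m i + n i) x" if "x \<in> space M" for m n x
    using zd_map_add[OF bij comm that] by simp
  have act_meas: "?act n \<in> measurable M M" if "\<And>i. n i \<ge> 0" for n
    using meas that by (intro zd_map_measurable) auto

  define G where "G = F \<union> (\<lambda>f i. - f i) ` F"
  have "finite G"
    using F(1) by (simp add: G_def)
  have G_nonzero: "\<exists>i\<in>{1..d}. f i \<noteq> 0" if "f \<in> G" for f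
    using that F(2) by (fastforce simp: G_def)
  define s :: "nat \<Rightarrow> int" where "s = (\<lambda>i. \<Sum>f\<in>G. \<bar>f i\<bar>)"
  have s_nonneg: "s i \<ge> 0" for i
    by (simp add: s_def sum_nonneg)
  have s_bound: "f i + s i \<ge> 0" if "f \<in> G" for f i
    using member_le_sum[OF that, of "\<lambda>f. \<bar>f i\<bar>"] \<open>finite G\<close> by (simp add: s_def)

  obtain U :: "nat \<Rightarrow> 'a set" where U [measurable]: "\<And>n. U n \<in> sets M"
    and U_sep: "\<And>x E. x \<in> space M \<Longrightarrow> finite E \<Longrightarrow> E \<subseteq> space M \<Longrightarrow> x \<notin> E \<Longrightarrow>
           \<exists>n. x \<in> U n \<and> U n \<inter> E = {}"
    using standard_borel_space_separating_sequence[OF borel] by metis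
  define c where "c = (\<lambda>x. LEAST n. x \<in> U n \<and> (\<forall>f\<in>G. ?act f x \<notin> U n))"
  have c: "x \<in> U (c x) \<and> (\<forall>f\<in>G. ?act f x \<notin> U (c x))" if x: "x \<in> space M" for x
  proof -
    have "x \<notin> (\<lambda>f. ?act f x) ` G"
      using free[OF x G_nonzero] by force
    then obtain n where "x \<in> U n" "U n \<inter> (\<lambda>f. ?act f x) ` G = {}"
      using U_sep[OF x, of "(\<lambda>f. ?act f x) ` G"] \<open>finite G\<close> act_space[OF x] by blast
    then have "x \<in> U n \<and> (\<forall>f\<in>G. ?act f x \<notin> U n)"
      by blast
    then show ?thesis
      unfolding c_def by (rule LeastI)
  qed
  have c_neq: "c (?act f x) \<noteq> c x" if "x \<in> space M" "f \<in> G" for f x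
    using c[OF that(1)] c[OF act_space[OF that(1)]] that(2) by metis
  \<comment> \<open>The colour of \<open>x\<close> involves the points \<open>T\<^sup>f x\<close>; a shift by \<open>g \<ge> s\<close> makes their exponents
    nonnegative.\<close>
  have c_meas: "(\<lambda>x. c (?act g x)) \<in> borel_measurable M"
    if g: "\<And>i. g i \<ge> s i" for g
  proof -
    have [measurable]: "?act g \<in> measurable M M"
      by (rule act_meas) (use g s_nonneg order_trans in blast)
    have [measurable]: "?act (\<lambda>i. f i + g i) \<in> measurable M M" if "f \<in> G" for f
    proof (rule act_meas)
      show "0 \<le> f i + g i" for i
        using s_bound[OF that, of i] g[of i] by linarith
    qed
    have "(\<lambda>x. LEAST n. ?act g x \<in> U n \<and> (\<forall>f\<in>G. ?act (\<lambda>i. f i + g i) x \<notin> U n))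
        \<in> measurable M (count_space UNIV)"
      using \<open>finite G\<close> [THEN countable_finite] by measurable
    then have "(\<lambda>x. c (?act g x)) \<in> measurable M (count_space UNIV)"
      by (subst measurable_cong) (simp_all add: c_def act_act)
    then show ?thesis
      by (rule measurable_compose[where g = "\<lambda>n. n"]) simp
  qed

  \<comment> \<open>One copy of \<open>s\<close> absorbs the displacement \<open>f\<close>, the other one serves \<open>c_meas\<close>.\<close>
  define A where "A = {x \<in> space M. \<forall>f\<in>G.
    c (?act (\<lambda>i. s i + s i) x) < c (?act (\<lambda>i. f i + (s i + s i)) x)}"
  have A_less: "c (?act (\<lambda>i. s i + s i) x) < c (?act (\<lambda>i. f i + (s i + s i)) x)"
    if "x \<in> A" "f \<in> G" for x f
    using that by (simp add: A_def)
  have "A \<in> sets M"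
  proof -
    have [measurable]: "(\<lambda>x. c (?act (\<lambda>i. s i + s i) x)) \<in> borel_measurable M"
      by (rule c_meas) (simp add: s_nonneg)
    have [measurable]: "(\<lambda>x. c (?act (\<lambda>i. f i + (s i + s i)) x)) \<in> borel_measurable M"
      if "f \<in> G" for f
    proof (rule c_meas)
      show "s i \<le> f i + (s i + s i)" for i
        using s_bound[OF that, of i] by linarith
    qed
    show ?thesis
      unfolding A_def
      by (intro sets.sets_Collect_finite_All borel_measurable_less \<open>finite G\<close>) measurable
  qed
  moreover have "zd_orbit M d T x \<inter> A \<noteq> {}" if x: "x \<in> space M" for x
  proof -
    obtain m where m: "\<And>n. c (?act m x) \<le> c (?act n x)"
      using ex_has_least_nat[of "\<lambda>_. True" _ "\<lambda>n. c (?act n x)"] by blast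
    \<comment> \<open>\<open>T\<^sup>m x\<close> is a strict local minimum, so its preimage under \<open>T\<^sup>2\<^sup>s\<close> lies in \<open>A\<close>.\<close>
    let ?z = "?act (\<lambda>i. m i - (s i + s i)) x"
    have "c (?act m x) < c (?act (\<lambda>i. f i + m i) x)" if "f \<in> G" for f
      using m[of "\<lambda>i. f i + m i"] c_neq[OF act_space[OF x, of m] that] by (simp add: act_act x)
    then have "?z \<in> A"
      by (simp add: A_def act_space act_act x algebra_simps)
    then show ?thesis
      by (auto simp: zd_orbit_def)
  qed
  moreover have "?act f x \<notin> A" if f: "f \<in> F" and xA: "x \<in> A" for f x
  proof
    assume fxA: "?act f x \<in> A"
    have x: "x \<in> space M"
      using xA by (simp add: A_def)
    have fG: "f \<in> G" "(\<lambda>i. - f i) \<in> G"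
      using f by (auto simp: G_def)
    have "c (?act (\<lambda>i. s i + s i) x) < c (?act (\<lambda>i. f i + (s i + s i)) x)"
      by (rule A_less[OF xA fG(1)])
    also have "\<dots> = c (?act (\<lambda>i. s i + s i) (?act f x))"
      by (simp add: act_act x add.commute)
    also have "\<dots> < c (?act (\<lambda>i. - f i + (s i + s i)) (?act f x))"
      using A_less[OF fxA fG(2)] by simp
    also have "\<dots> = c (?act (\<lambda>i. s i + s i) x)"
      by (simp add: act_act x)
    finally show False by simp
  qed
  ultimately show ?thesis
    using that unfolding complete_section_def by blast
qed

section \<open>Disjoint translates over a box\<close>

theorem theorem1p6:
  fixes M :: "'a measure" and d :: nat and T :: "nat \<Rightarrow> 'a \<Rightarrow> 'a" and t :: "nat \<Rightarrow> nat"
  assumes "standard_borel_space M"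
    and "d > 0"
    and "generate_free_borel_zd_action M d T"
    and "\<forall>i\<in>{1..d}. t i > 0"
  shows "\<exists>A\<in>sets M. complete_section M d T A \<and>
           disjoint_family_on (\<lambda>k. zd_map M T d k ` A) (\<Pi>\<^sub>E i\<in>{1..d}. {0..<int (t i)})"
proof -
  let ?P = "\<Pi>\<^sub>E i\<in>{1..d}. {0..<int (t i)}"
  define F where "F = {f. \<exists>k\<in>?P. \<exists>l\<in>?P. k \<noteq> l \<and> f = (\<lambda>i. k i - l i)}"
  have "finite ?P"
    by (intro finite_PiE) auto
  then have "finite (\<Union>k\<in>?P. (\<lambda>l i. k i - l i) ` ?P)"
    by (intro finite_UN_I finite_imageI)
  moreover have "F \<subseteq> (\<Union>k\<in>?P. (\<lambda>l i. k i - l i) ` ?P)"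
    unfolding F_def by blast
  ultimately have "finite F"
    by (rule finite_subset[rotated])
  moreover have "\<exists>i\<in>{1..d}. f i \<noteq> 0" if f: "f \<in> F" for f
  proof -
    obtain k l where kl: "k \<in> ?P" "l \<in> ?P" "k \<noteq> l" "f = (\<lambda>i. k i - l i)"
      using f unfolding F_def by blast
    then obtain i where "i \<in> {1..d}" "k i \<noteq> l i"
      using PiE_ext[of k "{1..d}" "\<lambda>i. {0..<int (t i)}" l] by blast
    with kl(4) show ?thesis by auto
  qed
  ultimately obtain A where A: "complete_section M d T A"
    and avoid: "\<And>f x. f \<in> F \<Longrightarrow> x \<in> A \<Longrightarrow> zd_map M T d f x \<notin> A"
    using complete_section_avoiding_translates[OF assms(1,3)] by metis
  have bij: "\<forall>i\<in>{1..d}. bij_betw (T i) (space M) (space M)"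
    and comm: "\<forall>i\<in>{1..d}. \<forall>j\<in>{1..d}. \<forall>x\<in>space M. T i (T j x) = T j (T i x)"
    using assms(3) unfolding generate_free_borel_zd_action_def borel_automorphism_def by auto
  have "A \<in> sets M"
    using A by (simp add: complete_section_def)
  have "zd_map M T d k x \<noteq> zd_map M T d l y"
    if kl: "k \<in> ?P" "l \<in> ?P" "k \<noteq> l" and xy: "x \<in> A" "y \<in> A" for k l x y
  proof
    assume eq: "zd_map M T d k x = zd_map M T d l y"
    have x: "x \<in> space M" and y: "y \<in> space M"
      using xy sets.sets_into_space[OF \<open>A \<in> sets M\<close>] by auto
    have zero: "zd_map M T e (\<lambda>_. 0) z = z" for e z
      by (induction e) (simp_all add: int_iterate_def)
    have "zd_map M T d (\<lambda>i. k i - l i) x = zd_map M T d (\<lambda>i. - l i) (zd_map M T d k x)"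
      by (simp flip: zd_map_add[OF bij comm x])
    also have "\<dots> = y"
      unfolding eq by (simp add: zero flip: zd_map_add[OF bij comm y])
    finally have "zd_map M T d (\<lambda>i. k i - l i) x \<in> A"
      using xy(2) by simp
    moreover have "(\<lambda>i. k i - l i) \<in> F"
      unfolding F_def using kl by blast
    ultimately show False
      using avoid[OF _ xy(1)] by blast
  qed
  then have "disjoint_family_on (\<lambda>k. zd_map M T d k ` A) ?P"
    unfolding disjoint_family_on_def by blast
  with A \<open>A \<in> sets M\<close> show ?thesis
    by blast
qed

end
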